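(* For any integer $k\geq 1$ and any $k$-regular graph $G$, $\chi_2(G)-\chi(G)\leq 6\ln k+2$.
   Context: Graphs are finite and simple. $\chi(G)$ denotes the chromatic number of $G$. A dynamic $l$-coloring of $G$ is a proper vertex coloring of $G$ with colors in $\{1,\ldots,l\}$ such that for every vertex $v$ of degree at least $2$, at least two different colors appear on the neighbors of $v$. The dynamic chromatic number $\chi_2(G)$ is the smallest integer $l$ such that $G$ has a dynamic $l$-coloring. $\ln$ is the natural logarithm. *)

theory Defs
  imports Complex_Main "Graph_Theory.Pair_Digraph"
begin

text \<open>
  A finite simple graph is a \<^locale>\<open>pair_graph\<close>: a finite set \<^const>\<open>pverts\<close> of vertices with a
  symmetric and loop-free set \<^const>\<open>parcs\<close> of ordered pairs, so that every undirected edge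
  occurs as two opposite arcs. The degree of a vertex is therefore its \<^const>\<open>out_degree\<close>.
\<close>

definition neighbors :: "'a pair_pre_digraph \<Rightarrow> 'a \<Rightarrow> 'a set" where
  "neighbors G v = {u. (v, u) \<in> parcs G}"

definition regular_graph :: "nat \<Rightarrow> 'a pair_pre_digraph \<Rightarrow> bool" where
  "regular_graph k G \<longleftrightarrow> (\<forall>v \<in> pverts G. out_degree (with_proj G) v = k)"

definition proper_coloring :: "'a pair_pre_digraph \<Rightarrow> nat \<Rightarrow> ('a \<Rightarrow> nat) \<Rightarrow> bool" where
  "proper_coloring G l c \<longleftrightarrow>
     c ` pverts G \<subseteq> {1..l} \<and> (\<forall>(u, v) \<in> parcs G. c u \<noteq> c v)"

definition dynamic_coloring :: "'a pair_pre_digraph \<Rightarrow> nat \<Rightarrow> ('a \<Rightarrow> nat) \<Rightarrow> bool" where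
  "dynamic_coloring G l c \<longleftrightarrow>
     proper_coloring G l c \<and>
     (\<forall>v \<in> pverts G. out_degree (with_proj G) v \<ge> 2 \<longrightarrow> card (c ` neighbors G v) \<ge> 2)"

definition chromatic_number :: "'a pair_pre_digraph \<Rightarrow> nat" where
  "chromatic_number G = (LEAST l. \<exists>c. proper_coloring G l c)"

definition dynamic_chromatic_number :: "'a pair_pre_digraph \<Rightarrow> nat" where
  "dynamic_chromatic_number G = (LEAST l. \<exists>c. dynamic_coloring G l c)"

lemma out_degree_eq_card_neighbors:
  "out_degree (with_proj G) v = card (neighbors G v)"
proof -
  have "out_arcs (with_proj G) v = Pair v ` neighbors G v"
    by (auto simp: out_arcs_def neighbors_def)
  then show ?thesis
    by (simp add: out_degree_def card_image inj_on_def)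
qed

text \<open>
  Every finite simple graph has a dynamic coloring, so neither \<open>LEAST\<close> above is vacuous.
\<close>

lemma (in pair_graph) dynamic_coloring_exists:
  "\<exists>c. dynamic_coloring G (card (pverts G)) c"
proof -
  from pair_finite_verts obtain c where c: "bij_betw c (pverts G) {1..card (pverts G)}"
    by (metis finite_same_card_bij finite_atLeastAtMost card_atLeastAtMost diff_Suc_1)
  then have inj: "inj_on c (pverts G)" and img: "c ` pverts G = {1..card (pverts G)}"
    by (auto simp: bij_betw_def)
  have "c u \<noteq> c v" if "(u, v) \<in> parcs G" for u v
    using that arc_fst_in_verts[OF that] arc_snd_in_verts[OF that] pair_no_loops[OF that] inj
    by (auto dest: inj_onD)
  moreover have "card (c ` neighbors G v) = card (neighbors G v)" for v
    by (rule card_image, rule inj_on_subset[OF inj])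
      (auto simp: neighbors_def dest: arc_snd_in_verts)
  ultimately have "dynamic_coloring G (card (pverts G)) c"
    using img by (auto simp: dynamic_coloring_def proper_coloring_def out_degree_eq_card_neighbors)
  then show ?thesis by blast
qed

lemma (in pair_graph) dynamic_coloring_dynamic_chromatic_number:
  "\<exists>c. dynamic_coloring G (dynamic_chromatic_number G) c"
  unfolding dynamic_chromatic_number_def
  by (rule LeastI_ex) (use dynamic_coloring_exists in blast)

lemma (in pair_graph) proper_coloring_chromatic_number:
  "\<exists>c. proper_coloring G (chromatic_number G) c"
  unfolding chromatic_number_def
  by (rule LeastI_ex) (use dynamic_coloring_exists in \<open>auto simp: dynamic_coloring_def\<close>)

end

theory Submission
  imports Defs "HOL-Probability.Probability"
begin

text \<open>
  Let \<open>G\<close> be \<open>k\<close>-regular and let \<open>m\<close> be the integer part of \<open>6 ln k + 2\<close>. The idea is to take an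
  optimal proper coloring and to recolor a suitable set \<open>T\<close> of vertices with \<open>m\<close> new colors. If
  every neighborhood meets both \<open>T\<close> and its complement, then every vertex sees a new and an old
  color; and if the subgraph induced by \<open>T\<close> has maximum degree less than \<open>m\<close>, then \<open>m\<close> colors
  suffice for \<open>T\<close> by greedy coloring. Such a set is found at random, by choosing each vertex with
  probability \<open>p\<close> about \<open>12/5 ln k / k\<close>: a neighborhood is missed with probability about
  \<open>k powr (-12/5)\<close>, and the Chernoff bound gives an even smaller bound for the probability that a
  vertex lies in \<open>T\<close> and has \<open>m\<close> or more neighbors there (lemma \<open>sparse_splitting_set\<close>). The bad
  event of a vertex depends only on those of the at most \<open>k\<^sup>2\<close> other vertices within distance two,
  so that the symmetric Lovasz local lemma applies as soon as the probability of each bad event is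
  at most \<open>1 / (4 k\<^sup>2)\<close>. The choice above achieves this for \<open>k \<ge> 94\<close>; for \<open>19 \<le> k \<le> 93\<close> explicit rational
  densities do (lemma \<open>sparse_density_exists\<close>).

  For \<open>2 \<le> k \<le> 18\<close> a bound without reference to the chromatic number is strong enough. By Hall's
  theorem each vertex \<open>v\<close> can be given two distinct neighbors \<open>f v\<close> and \<open>g v\<close> such that
  \<open>f\<close> and \<open>g\<close> are injective. Joining \<open>f v\<close> to \<open>g v\<close> for all \<open>v\<close> raises the degrees by at most
  two, and any proper coloring of the resulting graph is dynamic, so the dynamic chromatic number
  is at most \<open>k + 3\<close>. Since the chromatic number is at least \<open>2\<close> unless the graph is empty, it
  remains to see that \<open>k + 1 \<le> 6 ln k + 2\<close>, which is true up to \<open>k = 18\<close>. For \<open>k = 1\<close> every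
  proper coloring is dynamic.
\<close>

section \<open>Greedy coloring and systems of distinct representatives\<close>

lemma greedy_coloring:
  fixes E :: "'a \<Rightarrow> 'a \<Rightarrow> bool" and C :: "'c set"
  assumes "finite V" and "finite C"
    and sym: "\<And>u v. E u v \<Longrightarrow> E v u" and irrefl: "\<And>v. \<not> E v v"
    and deg: "\<And>v. v \<in> V \<Longrightarrow> card {u \<in> V. E v u} < card C"
  obtains c where "c ` V \<subseteq> C" and "\<And>u v. u \<in> V \<Longrightarrow> v \<in> V \<Longrightarrow> E u v \<Longrightarrow> c u \<noteq> c v"
proof -
  have "\<exists>c. c ` V \<subseteq> C \<and> (\<forall>u\<in>V. \<forall>v\<in>V. E u v \<longrightarrow> c u \<noteq> c v)"
    using \<open>finite V\<close> deg
  proof (induction V rule: finite_induct)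
    case empty
    then show ?case by simp
  next
    case (insert x V)
    have "card {u \<in> V. E v u} < card C" if "v \<in> V" for v
    proof -
      have "card {u \<in> V. E v u} \<le> card {u \<in> insert x V. E v u}"
        using insert.hyps by (intro card_mono) auto
      with insert.prems[of v] that show ?thesis by simp
    qed
    from insert.IH[OF this] obtain c
      where c: "c ` V \<subseteq> C" "\<forall>u\<in>V. \<forall>v\<in>V. E u v \<longrightarrow> c u \<noteq> c v"
      by auto
    have "card (c ` {u \<in> V. E x u}) \<le> card {u \<in> V. E x u}"
      using insert.hyps by (intro card_image_le) auto
    also have "\<dots> \<le> card {u \<in> insert x V. E x u}"
      using insert.hyps by (intro card_mono) auto
    also have "\<dots> < card C" using insert.prems by simp
    finally have "card (c ` {u \<in> V. E x u}) < card C" .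
    moreover have "finite (c ` {u \<in> V. E x u})" using insert.hyps by simp
    ultimately have "\<not> C \<subseteq> c ` {u \<in> V. E x u}" by (meson card_mono leD)
    then obtain a where a: "a \<in> C" "a \<notin> c ` {u \<in> V. E x u}" by blast
    have "(c(x := a)) u \<noteq> (c(x := a)) v" if "u \<in> insert x V" "v \<in> insert x V" "E u v" for u v
      using that a(2) c(2) sym[of u v] irrefl[of x] insert.hyps
      by (cases "u = x"; cases "v = x") (auto simp: image_iff)
    moreover have "(c(x := a)) ` insert x V \<subseteq> C" using a c by auto
    ultimately show ?case by blast
  qed
  then obtain c where "c ` V \<subseteq> C" "\<forall>u\<in>V. \<forall>v\<in>V. E u v \<longrightarrow> c u \<noteq> c v" by auto
  then show ?thesis by (intro that[of c]) auto
qed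

text \<open>
  Hall's theorem, by Rado's argument: as long as some set of the family has two elements, one of
  these can be deleted from it without violating Hall's condition; once all sets are singletons,
  the condition makes them distinct.
\<close>
lemma hall_marriage:
  fixes A :: "'i \<Rightarrow> 'a set"
  assumes "finite I" and "\<And>i. i \<in> I \<Longrightarrow> finite (A i)"
    and "\<And>J. J \<subseteq> I \<Longrightarrow> card J \<le> card (\<Union>j\<in>J. A j)"
  obtains f where "inj_on f I" and "\<And>i. i \<in> I \<Longrightarrow> f i \<in> A i"
proof -
  have "\<exists>f. inj_on f I \<and> (\<forall>i\<in>I. f i \<in> A i)"
    using assms(2,3)
  proof (induction "\<Sum>i\<in>I. card (A i)" arbitrary: A rule: less_induct)
    case less
    note fin = less.prems(1) and hall = less.prems(2)
    have nonempty: "A i \<noteq> {}" if "i \<in> I" for i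
      using hall[of "{i}"] that by auto
    show ?case
    proof (cases "\<forall>i\<in>I. \<exists>a. A i = {a}")
      case True
      then obtain f where f: "\<And>i. i \<in> I \<Longrightarrow> A i = {f i}" by metis
      have "inj_on f I"
      proof (rule inj_onI, rule ccontr)
        fix i j assume ij: "i \<in> I" "j \<in> I" "f i = f j" "i \<noteq> j"
        with hall[of "{i, j}"] f show False by auto
      qed
      with f show ?thesis by blast
    next
      case False
      then obtain i where i: "i \<in> I" "\<And>a. A i \<noteq> {a}" by blast
      with nonempty obtain x y where xy: "x \<in> A i" "y \<in> A i" "x \<noteq> y" by blast
      define B where "B z = A(i := A i - {z})" for z
      have shrink: "\<exists>f. inj_on f I \<and> (\<forall>i\<in>I. f i \<in> A i)"
        if z: "z \<in> A i" and B: "\<And>J. J \<subseteq> I \<Longrightarrow> card J \<le> card (\<Union>j\<in>J. B z j)" for z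
      proof -
        have "(\<Sum>j\<in>I. card (B z j)) < (\<Sum>j\<in>I. card (A j))"
        proof (rule sum_strict_mono_ex1)
          show "\<forall>j\<in>I. card (B z j) \<le> card (A j)"
            using fin by (auto simp: B_def intro!: card_mono)
          show "\<exists>j\<in>I. card (B z j) < card (A j)"
            using fin i(1) z by (intro bexI[of _ i]) (simp add: B_def card_Diff1_less del: card_Diff_insert)
        qed (fact \<open>finite I\<close>)
        moreover have "finite (B z j)" if "j \<in> I" for j using fin that i by (auto simp: B_def)
        ultimately obtain f where "inj_on f I" "\<forall>j\<in>I. f j \<in> B z j"
          using less.hyps[of "B z"] B by blast
        then show ?thesis
          by (intro exI[of _ f]) (auto simp: B_def split: if_splits)
      qed
      show ?thesis
      proof (rule ccontr)
        assume no: "\<not> ?thesis"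
        have viol: "\<exists>J. J \<subseteq> I - {i} \<and> card (A i - {z} \<union> (\<Union>j\<in>J. A j)) \<le> card J" if z: "z \<in> A i" for z
        proof -
          from no shrink[OF z] obtain J where J: "J \<subseteq> I" "card (\<Union>j\<in>J. B z j) < card J"
            by (meson leI)
          have "i \<in> J"
          proof (rule ccontr)
            assume "i \<notin> J"
            then have "(\<Union>j\<in>J. B z j) = (\<Union>j\<in>J. A j)" by (auto simp: B_def)
            with J hall[of J] show False by simp
          qed
          have eq: "(\<Union>j\<in>J. B z j) = A i - {z} \<union> (\<Union>j\<in>J - {i}. A j)"
            using \<open>i \<in> J\<close> by (auto simp: B_def split: if_splits)
          have "card J = Suc (card (J - {i}))"
            using \<open>i \<in> J\<close> J \<open>finite I\<close> by (metis card.remove finite_subset)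
          with J eq show ?thesis by (intro exI[of _ "J - {i}"]) auto
        qed
        \<comment> \<open>If neither \<open>x\<close> nor \<open>y\<close> can be deleted, the two violating subfamilies contradict
          Hall's condition for their union and intersection, by submodularity of the size
          of a union.\<close>
        obtain J K where J: "J \<subseteq> I - {i}" "card (A i - {x} \<union> (\<Union>j\<in>J. A j)) \<le> card J"
          and K: "K \<subseteq> I - {i}" "card (A i - {y} \<union> (\<Union>j\<in>K. A j)) \<le> card K"
          using viol xy by meson
        define P Q where "P = A i - {x} \<union> (\<Union>j\<in>J. A j)" and "Q = A i - {y} \<union> (\<Union>j\<in>K. A j)"
        have "finite J" "finite K" using J(1) K(1) \<open>finite I\<close> by (meson finite_Diff finite_subset)+
        moreover have "j \<in> I" if "j \<in> J \<union> K" for j using that J(1) K(1) by blast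
        ultimately have fins: "finite J" "finite K" "finite P" "finite Q"
          using fin i(1) by (auto simp: P_def Q_def)
        have "card (insert i (J \<union> K)) \<le> card (\<Union>j\<in>insert i (J \<union> K). A j)"
          using J K i by (intro hall) auto
        also have "(\<Union>j\<in>insert i (J \<union> K). A j) = P \<union> Q"
          using xy by (auto simp: P_def Q_def)
        finally have 1: "card (J \<union> K) + 1 \<le> card (P \<union> Q)"
          using J K fins by (subst (asm) card_insert_disjoint) auto
        have "card (J \<inter> K) \<le> card (\<Union>j\<in>J \<inter> K. A j)" using J by (intro hall) auto
        also have "\<dots> \<le> card (P \<inter> Q)" using fins by (intro card_mono) (auto simp: P_def Q_def)
        finally have 2: "card (J \<inter> K) \<le> card (P \<inter> Q)" .
        have "card P + card Q = card (P \<union> Q) + card (P \<inter> Q)"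
          "card J + card K = card (J \<union> K) + card (J \<inter> K)"
          by (rule card_Un_Int; fact fins)+
        with 1 2 J(2) K(2) show False by (simp add: P_def Q_def)
      qed
    qed
  qed
  then obtain f where "inj_on f I" "\<forall>i\<in>I. f i \<in> A i" by auto
  then show ?thesis by (intro that[of f]) auto
qed

text \<open>
  Hall's condition follows by counting incidences: the sets indexed by \<open>J\<close> have \<open>d * card J\<close>
  incidences with their union, and each point accounts for at most \<open>d\<close> of them.
\<close>
lemma regular_family_representatives:
  fixes A :: "'i \<Rightarrow> 'a set"
  assumes "finite I" and "d > 0"
    and A: "\<And>i. i \<in> I \<Longrightarrow> finite (A i) \<and> card (A i) = d"
    and deg: "\<And>x. card {i \<in> I. x \<in> A i} \<le> d"
  obtains f where "inj_on f I" and "\<And>i. i \<in> I \<Longrightarrow> f i \<in> A i"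
proof (rule hall_marriage[OF \<open>finite I\<close>])
  show "finite (A i)" if "i \<in> I" for i using A that by blast
  fix J assume J: "J \<subseteq> I"
  then have finJ: "finite J" and finU: "finite (\<Union>j\<in>J. A j)"
    using \<open>finite I\<close> A by (auto intro: finite_subset)
  have "d * card J = (\<Sum>j\<in>J. card {x \<in> \<Union>j\<in>J. A j. x \<in> A j})"
  proof -
    have "{x \<in> \<Union>j\<in>J. A j. x \<in> A j} = A j" if "j \<in> J" for j using that by auto
    then have "(\<Sum>j\<in>J. card {x \<in> \<Union>j\<in>J. A j. x \<in> A j}) = (\<Sum>j\<in>J. d)"
      using A J by (intro sum.cong) auto
    then show ?thesis by simp
  qed
  also have "\<dots> = (\<Sum>x\<in>(\<Union>j\<in>J. A j). card {j \<in> J. x \<in> A j})"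
    using sum_card_image sum.swap_restrict[OF finJ finU, of "\<lambda>_ _. 1::nat" "\<lambda>j x. x \<in> A j"] by simp
  also have "\<dots> \<le> (\<Sum>x\<in>(\<Union>j\<in>J. A j). d)"
  proof (rule sum_mono)
    fix x
    have "card {j \<in> J. x \<in> A j} \<le> card {i \<in> I. x \<in> A i}"
      using J \<open>finite I\<close> by (intro card_mono) auto
    with deg[of x] show "card {j \<in> J. x \<in> A j} \<le> d" by linarith
  qed
  finally show "card J \<le> card (\<Union>j\<in>J. A j)" using \<open>d > 0\<close> by (simp add: mult.commute)
qed (rule that)

section \<open>The symmetric Lovasz local lemma\<close>

text \<open>
  If each event has probability at most \<open>q\<close> and is independent of all conjunctions of
  complements of events outside a set of at most \<open>d\<close> others, then \<open>4 q d \<le> 1\<close> suffices for all events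
  to be avoidable at once. Conditional probabilities are written as products, so that no
  division by a possibly vanishing probability occurs.
\<close>
lemma (in prob_space) lovasz_local_lemma_symmetric:
  fixes A :: "'i \<Rightarrow> 'a set" and D :: "'i \<Rightarrow> 'i set" and d :: nat
  assumes "finite I" and ev: "\<And>i. i \<in> I \<Longrightarrow> A i \<in> events"
    and q: "\<And>i. i \<in> I \<Longrightarrow> prob (A i) \<le> q" 
    and D: "\<And>i. i \<in> I \<Longrightarrow> finite (D i) \<and> card (D i) \<le> d"
    and indep: "\<And>i S. i \<in> I \<Longrightarrow> S \<subseteq> I - {i} - D i \<Longrightarrow>
      prob (A i \<inter> (space M - (\<Union>j\<in>S. A j))) = prob (A i) * prob (space M - (\<Union>j\<in>S. A j))"
    and "d \<ge> 1" and small: "4 * q * real d \<le> 1"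
  shows "prob (space M - (\<Union>i\<in>I. A i)) > 0"
proof (cases "I = {}")
  case True
  then show ?thesis by (simp add: prob_space)
next
  case False
  define C where "C S = space M - (\<Union>j\<in>S. A j)" for S
  have C_ev: "C S \<in> events" if "S \<subseteq> I" for S
    unfolding C_def using that ev \<open>finite I\<close> by (intro sets.Diff sets.finite_UN) (auto intro: finite_subset)
  have q0: "q \<ge> 0" using False q measure_nonneg order_trans by blast
  \<comment> \<open>Given that the events in \<open>S\<close> fail, the event \<open>A i\<close> has conditional probability at most
    \<open>2 q\<close>.\<close>
  have cond: "prob (A i \<inter> C S) \<le> 2 * q * prob (C S)" if "i \<in> I" "S \<subseteq> I - {i}" for i S
    using that
  proof (induction "card S" arbitrary: i S rule: less_induct)
    case less
    define S1 S2 where "S1 = S \<inter> D i" and "S2 = S - D i"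
    have sub: "S \<subseteq> I" "S1 \<subseteq> I" "S2 \<subseteq> I" "S1 \<subseteq> S" "S2 \<subseteq> S" "S = S1 \<union> S2"
      using less.prems by (auto simp: S1_def S2_def)
    have finS: "finite S" using sub \<open>finite I\<close> by (meson finite_subset)
    have "prob (A i \<inter> C S) \<le> prob (A i \<inter> C S2)"
      using sub less.prems ev C_ev by (intro finite_measure_mono) (auto simp: C_def)
    also have "\<dots> = prob (A i) * prob (C S2)"
      unfolding C_def using less.prems by (intro indep) (auto simp: S2_def)
    also have "\<dots> \<le> q * prob (C S2)"
      using q less.prems by (intro mult_right_mono) auto
    also have "prob (C S2) \<le> 2 * prob (C S)"
    proof (cases "S1 = {}")
      case True
      then show ?thesis using sub by simp
    next
      case False
      then have "S2 \<subset> S" by (auto simp: S1_def S2_def)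
      then have smaller: "card S2 < card S" using finS by (intro psubset_card_mono)
      have A_ev: "A j \<in> events" if "j \<in> S1" for j using that sub ev by blast
      have CS_ev: "C S \<in> events" "C S2 \<in> events" using sub C_ev by blast+
      have "finite S1" using sub finS by (meson finite_subset)
      then have U_ev: "(\<Union>j\<in>S1. A j \<inter> C S2) \<in> events"
        using A_ev CS_ev by (intro sets.finite_UN sets.Int) auto
      have "prob (C S2) \<le> prob (C S \<union> (\<Union>j\<in>S1. A j \<inter> C S2))"
      proof (rule finite_measure_mono)
        show "C S2 \<subseteq> C S \<union> (\<Union>j\<in>S1. A j \<inter> C S2)"
          unfolding C_def \<open>S = S1 \<union> S2\<close> by blast
      qed (use CS_ev U_ev in auto)
      also have "\<dots> \<le> prob (C S) + prob (\<Union>j\<in>S1. A j \<inter> C S2)"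
        using CS_ev(1) U_ev by (rule measure_Un_le)
      also have "prob (\<Union>j\<in>S1. A j \<inter> C S2) \<le> (\<Sum>j\<in>S1. prob (A j \<inter> C S2))"
        using A_ev CS_ev \<open>finite S1\<close> by (intro finite_measure_subadditive_finite) auto
      also have "\<dots> \<le> (\<Sum>j\<in>S1. 2 * q * prob (C S2))"
      proof (rule sum_mono)
        fix j assume "j \<in> S1"
        then have "j \<in> I" "S2 \<subseteq> I - {j}" using less.prems(2) by (auto simp: S1_def S2_def)
       
        with smaller show "prob (A j \<inter> C S2) \<le> 2 * q * prob (C S2)" by (rule less.hyps)
      qed
      also have "\<dots> = real (card S1) * (2 * q * prob (C S2))" by simp
      also have "\<dots> \<le> real d * (2 * q * prob (C S2))"
      proof -
        have "card S1 \<le> card (D i)" using D less.prems by (intro card_mono) (auto simp: S1_def)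
        also have "\<dots> \<le> d" using D less.prems by blast
        finally show ?thesis using q0 by (intro mult_right_mono) auto
      qed
      also have "\<dots> = (4 * q * real d) * (prob (C S2) / 2)" by simp
      also have "\<dots> \<le> 1 * (prob (C S2) / 2)" using small by (intro mult_right_mono) auto
      finally show ?thesis by simp
    qed
    finally show ?case using q0 by (simp add: mult_left_mono)
  qed
  have "4 * q * 1 \<le> 4 * q * real d" using q0 \<open>d \<ge> 1\<close> by (intro mult_left_mono) auto
  with small have q1: "2 * q < 1" by simp
  have "prob (C S) > 0" if "S \<subseteq> I" for S
    using finite_subset[OF that \<open>finite I\<close>] that
  proof (induction S rule: finite_induct)
    case empty
    then show ?case by (simp add: C_def prob_space)
  next
    case (insert j S)
    have "0 < (1 - 2 * q) * prob (C S)" using insert q1 by simp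
    also have "\<dots> \<le> prob (C S) - prob (A j \<inter> C S)"
      using cond[of j S] insert by (auto simp: algebra_simps)
    also have "\<dots> = prob (C S - A j \<inter> C S)"
      using insert ev C_ev by (subst finite_measure_Diff) auto
    also have "C S - A j \<inter> C S = C (insert j S)" by (auto simp: C_def)
    finally show ?case .
  qed
  then show ?thesis by (simp add: C_def)
qed

section \<open>Random vertex sets\<close>

lemma prob_Pi_pmf_independent:
  fixes q :: "'a \<Rightarrow> 'b pmf"
  assumes "finite V" and "X \<inter> Y = {}"
    and A: "\<And>f g. (\<And>x. x \<in> X \<Longrightarrow> f x = g x) \<Longrightarrow> f \<in> A \<Longrightarrow> g \<in> A"
    and B: "\<And>f g. (\<And>x. x \<in> Y \<Longrightarrow> f x = g x) \<Longrightarrow> f \<in> B \<Longrightarrow> g \<in> B"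
  shows "measure_pmf.prob (Pi_pmf V dflt q) (A \<inter> B)
    = measure_pmf.prob (Pi_pmf V dflt q) A * measure_pmf.prob (Pi_pmf V dflt q) B"
proof -
  define P1 P2 where "P1 = Pi_pmf (V \<inter> X) dflt q" and "P2 = Pi_pmf (V - X) dflt q"
  define h where "h = (\<lambda>(f, g) x. if x \<in> V \<inter> X then f x else g x :: 'b)"
  have eq: "Pi_pmf V dflt q = map_pmf h (pair_pmf P1 P2)"
    using Pi_pmf_union[of "V \<inter> X" "V - X" dflt q] \<open>finite V\<close>
    by (auto simp: h_def P1_def P2_def Int_Diff_Un Int_Diff_disjoint)
  have out: "f x = dflt" if "f \<in> set_pmf (Pi_pmf W dflt q)" "x \<notin> W" "finite W" for f x W
    using set_Pi_pmf_subset[OF \<open>finite W\<close>, of dflt q] that by auto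
  have hA: "h (f, g) \<in> A \<longleftrightarrow> f \<in> A" if "f \<in> set_pmf P1" "g \<in> set_pmf P2" for f g
  proof -
    have "h (f, g) x = f x" if "x \<in> X" for x
      using that \<open>f \<in> _\<close> \<open>g \<in> _\<close> out[of f "V \<inter> X" x] out[of g "V - X" x] \<open>finite V\<close>
      by (auto simp: h_def P1_def P2_def)
    then show ?thesis using A[of "h (f, g)" f] A[of f "h (f, g)"] by metis
  qed
  have hB: "h (f, g) \<in> B \<longleftrightarrow> g \<in> B" for f g
  proof -
    have "h (f, g) x = g x" if "x \<in> Y" for x
      using that \<open>X \<inter> Y = {}\<close> by (auto simp: h_def)
    then show ?thesis using B[of "h (f, g)" g] B[of g "h (f, g)"] by metis
  qed
  have rect: "measure_pmf.prob (pair_pmf P1 P2) E = measure_pmf.prob P1 E1 * measure_pmf.prob P2 E2"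
    if "\<And>f g. f \<in> set_pmf P1 \<Longrightarrow> g \<in> set_pmf P2 \<Longrightarrow> (f, g) \<in> E \<longleftrightarrow> f \<in> E1 \<and> g \<in> E2" for E E1 E2
  proof -
    have "measure_pmf.prob (pair_pmf P1 P2) E
        = measure_pmf.prob (pair_pmf P1 P2) ((E1 \<inter> set_pmf P1) \<times> (E2 \<inter> set_pmf P2))"
      using that by (intro measure_prob_cong_0) (auto simp: set_pmf_iff pmf_pair)
    also have "\<dots> = measure_pmf.prob P1 (E1 \<inter> set_pmf P1) * measure_pmf.prob P2 (E2 \<inter> set_pmf P2)"
      by (intro measure_pmf_prob_product) auto
    finally show ?thesis by (simp add: measure_Int_set_pmf)
  qed
  show ?thesis
    unfolding eq measure_map_pmf
    using rect[of "h -` (A \<inter> B)" A B] rect[of "h -` A" A UNIV] rect[of "h -` B" UNIV B] hA hB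
    by simp
qed



lemma prob_Pi_pmf_Pi_subset:
  assumes "finite V" and "S \<subseteq> V"
  shows "measure_pmf.prob (Pi_pmf V dflt q) (Pi S B) = (\<Prod>x\<in>S. measure_pmf.prob (q x) (B x))"
proof -
  have "Pi S B = Pi V (\<lambda>x. if x \<in> S then B x else UNIV)"
    using assms by (fastforce simp: Pi_def)
  then have "measure_pmf.prob (Pi_pmf V dflt q) (Pi S B)
      = (\<Prod>x\<in>V. measure_pmf.prob (q x) (if x \<in> S then B x else UNIV))"
    using assms by (simp add: measure_Pi_pmf_Pi)
  also have "\<dots> = (\<Prod>x\<in>S. measure_pmf.prob (q x) (B x))"
    using assms by (intro prod.mono_neutral_cong_right) auto
  finally show ?thesis .
qed

text \<open>The Chernoff bound: Markov's inequality for \<open>l\<close> to the number of chosen points of \<open>S\<close>.\<close>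
lemma prob_Pi_bernoulli_card_ge:
  fixes p l :: real
  assumes "finite V" and "S \<subseteq> V" and "0 \<le> p" "p \<le> 1" and "l \<ge> 1"
  shows "measure_pmf.prob (Pi_pmf V False (\<lambda>_. bernoulli_pmf p)) {f. m \<le> card {x \<in> S. f x}}
    \<le> (1 + (l - 1) * p) ^ card S / l ^ m"
proof -
  define M where "M = Pi_pmf V False (\<lambda>_. bernoulli_pmf p)"
  define g where "g x b = (if x \<in> S \<and> b then l else 1)" for x :: 'a and b
  have finS: "finite S" using assms finite_subset by blast
  have "finite (set_pmf M)"
    unfolding M_def
    by (rule finite_subset[OF set_Pi_pmf_subset'[OF \<open>finite V\<close>]])
      (use \<open>finite V\<close> in \<open>auto intro: finite_subset[of _ UNIV]\<close>)
  then have int: "integrable (measure_pmf M) (\<lambda>f. \<Prod>x\<in>V. g x (f x))"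
    by (rule integrable_measure_pmf_finite)
  have g_prod: "(\<Prod>x\<in>V. g x (f x)) = l ^ card {x \<in> S. f x}" for f
  proof -
    have "(\<Prod>x\<in>V. g x (f x)) = (\<Prod>x\<in>{x \<in> S. f x}. l)"
      using assms by (intro prod.mono_neutral_cong_right) (auto simp: g_def)
    then show ?thesis by simp
  qed
  have "measure_pmf.prob M {f. m \<le> card {x \<in> S. f x}}
      \<le> measure_pmf.prob M {f \<in> space (measure_pmf M). (\<Prod>x\<in>V. g x (f x)) \<ge> l ^ m}"
    unfolding g_prod using \<open>l \<ge> 1\<close>
    by (intro measure_pmf.finite_measure_mono) (auto intro: power_increasing)
  also have "\<dots> \<le> measure_pmf.expectation M (\<lambda>f. \<Prod>x\<in>V. g x (f x)) / l ^ m"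
    using int \<open>l \<ge> 1\<close> by (intro integral_Markov_inequality_measure[where A = UNIV])
      (auto simp: g_def intro!: prod_nonneg)
  also have "measure_pmf.expectation M (\<lambda>f. \<Prod>x\<in>V. g x (f x))
      = (\<Prod>x\<in>V. measure_pmf.expectation (bernoulli_pmf p) (g x))"
    unfolding M_def using \<open>finite V\<close> \<open>l \<ge> 1\<close>
    by (intro expectation_prod_Pi_pmf) (auto simp: g_def intro: integrable_measure_pmf_finite)
  also have "\<dots> = (\<Prod>x\<in>S. 1 + (l - 1) * p)"
    using assms by (intro prod.mono_neutral_cong_right) (auto simp: g_def algebra_simps)
  finally show ?thesis by (simp add: M_def)
qed

text \<open>
  In the local lemma, the bad event of \<open>v\<close> is determined by the closed neighborhood of \<open>v\<close>, so
  that \<open>D\<close> below collects the vertices whose events may depend on it.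
\<close>
lemma card_vertices_at_distance_le_2:
  fixes N :: "'a \<Rightarrow> 'a set"
  assumes N: "\<And>v. v \<in> V \<Longrightarrow> N v \<subseteq> V \<and> finite (N v) \<and> card (N v) = k"
    and sym: "\<And>u v. v \<in> V \<Longrightarrow> u \<in> N v \<Longrightarrow> v \<in> N u"
    and "v \<in> V"
  defines "D \<equiv> {w \<in> V. w \<noteq> v \<and> insert w (N w) \<inter> insert v (N v) \<noteq> {}}"
  shows "finite D" and "card D \<le> k\<^sup>2"
proof -
  have NV: "finite (N v)" "card (N v) = k" "N v \<subseteq> V" using N \<open>v \<in> V\<close> by auto
  have sub: "D \<subseteq> N v \<union> (\<Union>u\<in>N v. N u - {v})"
    unfolding D_def using sym \<open>v \<in> V\<close> by blast
  have fin: "finite (N v \<union> (\<Union>u\<in>N v. N u - {v}))" using NV N by blast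
  with sub show "finite D" by (rule finite_subset)
  have "card D \<le> card (N v \<union> (\<Union>u\<in>N v. N u - {v}))" using sub fin by (intro card_mono)
  also have "\<dots> \<le> card (N v) + card (\<Union>u\<in>N v. N u - {v})" by (rule card_Un_le)
  also have "card (\<Union>u\<in>N v. N u - {v}) \<le> (\<Sum>u\<in>N v. card (N u - {v}))"
    using NV by (intro card_UN_le)
  also have "\<dots> = (\<Sum>u\<in>N v. k - 1)"
  proof (rule sum.cong)
    fix u assume u: "u \<in> N v"
    then show "card (N u - {v}) = k - 1"
      using sym[OF \<open>v \<in> V\<close> u] N[of u] NV by auto
  qed simp
  also have "card (N v) + \<dots> = k\<^sup>2"
    using NV by (cases k) (auto simp: power2_eq_square)
  finally show "card D \<le> k\<^sup>2" by simp
qed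

text \<open>
  The probabilistic core, for a \<open>k\<close>-regular graph on \<open>V\<close> given by its neighborhoods \<open>N v\<close>:
  there is a set \<open>T\<close> that splits every neighborhood and induces a subgraph of maximum degree less
  than \<open>m\<close>. It is a random set containing each vertex with probability \<open>p\<close>.
  The bad event of \<open>v\<close> is that \<open>N v\<close> misses \<open>T\<close>, or lies in \<open>T\<close>, or that \<open>v\<close> is in \<open>T\<close> and
  has at least \<open>m\<close> neighbors in \<open>T\<close>; the three summands of \<open>small\<close> bound these three
  probabilities. In the last one, the factor \<open>p\<close> is gained because \<open>v\<close> is not its own
  neighbor, so that \<open>v \<in> T\<close> is independent of \<open>N v \<inter> T\<close>.
\<close>
lemma sparse_splitting_set:
  fixes N :: "'a \<Rightarrow> 'a set" and p l :: real
  assumes "finite V" and "k \<ge> 1"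
    and N: "\<And>v. v \<in> V \<Longrightarrow> N v \<subseteq> V \<and> card (N v) = k"
    and sym: "\<And>u v. v \<in> V \<Longrightarrow> u \<in> N v \<Longrightarrow> v \<in> N u"
    and irrefl: "\<And>v. v \<notin> N v"
    and "0 \<le> p" "p \<le> 1" "l \<ge> 1"
    and small: "4 * (real k)\<^sup>2 * ((1 - p) ^ k + p ^ k + p * ((1 + (l - 1) * p) ^ k / l ^ m)) \<le> 1"
  obtains T where "T \<subseteq> V"
    and "\<And>v. v \<in> V \<Longrightarrow> N v \<inter> T \<noteq> {} \<and> \<not> N v \<subseteq> T"
    and "\<And>v. v \<in> T \<Longrightarrow> card (N v \<inter> T) < m"
proof -
  define M where "M = Pi_pmf V False (\<lambda>_. bernoulli_pmf p)"
  define all where "all v b = {f. \<forall>x\<in>N v. f x = b}" for v and b :: bool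
  define many where "many v = {f. f v \<and> m \<le> card {x \<in> N v. f x}}" for v
  define A where "A v = all v False \<union> all v True \<union> many v" for v
  define D where "D v = {w \<in> V. w \<noteq> v \<and> insert w (N w) \<inter> insert v (N v) \<noteq> {}}" for v
  have finN: "finite (N v)" if "v \<in> V" for v using N that \<open>finite V\<close> finite_subset by blast
  have A_local: "g \<in> A v" if "f \<in> A v" "\<And>x. x \<in> insert v (N v) \<Longrightarrow> f x = g x" for f g v
  proof -
    have "{x \<in> N v. f x} = {x \<in> N v. g x}" "f v = g v" using that(2) by auto
    then show ?thesis using that by (auto simp: A_def all_def many_def)
  qed
  have prob_all: "measure_pmf.prob M (all v b) = (if b then p else 1 - p) ^ k" if "v \<in> V" for v b
  proof -
    have "all v b = Pi (N v) (\<lambda>_. {b})" by (auto simp: all_def)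
    moreover have "measure_pmf.prob M (Pi (N v) (\<lambda>_. {b}))
        = (\<Prod>x\<in>N v. measure_pmf.prob (bernoulli_pmf p) {b})"
      unfolding M_def using \<open>finite V\<close> N that by (intro prob_Pi_pmf_Pi_subset) auto
    ultimately show ?thesis
      using N that \<open>0 \<le> p\<close> \<open>p \<le> 1\<close> by (simp add: measure_pmf_single)
  qed
  have prob_many: "measure_pmf.prob M (many v) \<le> p * ((1 + (l - 1) * p) ^ k / l ^ m)"
    if "v \<in> V" for v
  proof -
    have "measure_pmf.prob M ({f. f v} \<inter> {f. m \<le> card {x \<in> N v. f x}})
        = measure_pmf.prob M {f. f v} * measure_pmf.prob M {f. m \<le> card {x \<in> N v. f x}}"
      unfolding M_def
    proof (rule prob_Pi_pmf_independent[OF \<open>finite V\<close>, of "{v}" "N v"])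
      show "{v} \<inter> N v = {}" using irrefl by auto
      show "g \<in> {f. m \<le> card {x \<in> N v. f x}}"
        if "f \<in> {f. m \<le> card {x \<in> N v. f x}}" "\<And>x. x \<in> N v \<Longrightarrow> f x = g x" for f g
      proof -
        have "{x \<in> N v. f x} = {x \<in> N v. g x}" using that(2) by auto
        then show ?thesis using that(1) by simp
      qed
    qed simp
    also have "measure_pmf.prob M {f. f v} = p"
    proof -
      have "{f. f v} = Pi {v} (\<lambda>_. {True})" by auto
      then show ?thesis
        unfolding M_def using \<open>finite V\<close> that \<open>0 \<le> p\<close> \<open>p \<le> 1\<close>
        by (simp add: prob_Pi_pmf_Pi_subset measure_pmf_single)
    qed
    also have "p * measure_pmf.prob M {f. m \<le> card {x \<in> N v. f x}}
        \<le> p * ((1 + (l - 1) * p) ^ card (N v) / l ^ m)"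
      unfolding M_def using assms that
      by (intro mult_left_mono prob_Pi_bernoulli_card_ge) auto
    finally show ?thesis using N that by (simp add: many_def Int_def)
  qed
  define q where "q = (1 - p) ^ k + p ^ k + p * ((1 + (l - 1) * p) ^ k / l ^ m)"
  have q_small: "4 * q * real (k\<^sup>2) \<le> 1"
    using small unfolding q_def[symmetric] by (simp add: mult_ac)
  have "measure_pmf.prob M (space (measure_pmf M) - (\<Union>v\<in>V. A v)) > 0"
  proof (rule measure_pmf.lovasz_local_lemma_symmetric[where D = D and d = "k\<^sup>2" and q = q])
    fix v assume v: "v \<in> V"
    have "measure_pmf.prob M (A v)
        \<le> measure_pmf.prob M (all v False) + measure_pmf.prob M (all v True) + measure_pmf.prob M (many v)"
      unfolding A_def
      by (intro order_trans[OF measure_Un_le] add_mono order_refl) auto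
    also have "\<dots> \<le> q"
      using prob_all[OF v, of True] prob_all[OF v, of False] prob_many[OF v] by (simp add: q_def)
    finally show "measure_pmf.prob M (A v) \<le> q" .
    show "finite (D v) \<and> card (D v) \<le> k\<^sup>2"
      unfolding D_def using card_vertices_at_distance_le_2[of V N k v] N sym finN v by blast
    fix S assume S: "S \<subseteq> V - {v} - D v"
    show "measure_pmf.prob M (A v \<inter> (space (measure_pmf M) - (\<Union>j\<in>S. A j)))
        = measure_pmf.prob M (A v) * measure_pmf.prob M (space (measure_pmf M) - (\<Union>j\<in>S. A j))"
      unfolding M_def
    proof (rule prob_Pi_pmf_independent[OF \<open>finite V\<close>, of "insert v (N v)" "\<Union>j\<in>S. insert j (N j)"])
      show "insert v (N v) \<inter> (\<Union>j\<in>S. insert j (N j)) = {}"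
        using S by (fastforce simp: D_def)
      show "g \<in> A v" if "f \<in> A v" "\<And>x. x \<in> insert v (N v) \<Longrightarrow> f x = g x" for f g
        using A_local that by blast
      fix f g :: "'a \<Rightarrow> bool"
      assume eq: "\<And>x. x \<in> (\<Union>j\<in>S. insert j (N j)) \<Longrightarrow> f x = g x"
        and f: "f \<in> space (measure_pmf (Pi_pmf V False (\<lambda>_. bernoulli_pmf p))) - (\<Union>j\<in>S. A j)"
      have "g \<notin> A j" if "j \<in> S" for j
        using A_local[of g j f] eq f that by auto
      then show "g \<in> space (measure_pmf (Pi_pmf V False (\<lambda>_. bernoulli_pmf p))) - (\<Union>j\<in>S. A j)"
        by simp
    qed
  qed (use \<open>finite V\<close> \<open>k \<ge> 1\<close> q_small in auto)
  then obtain f where f: "f \<notin> (\<Union>v\<in>V. A v)"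
    by (metis DiffE equals0I measure_empty less_irrefl)
  define T where "T = {v \<in> V. f v}"
  have T_eq: "N v \<inter> T = {x \<in> N v. f x}" if "v \<in> V" for v using N that by (auto simp: T_def)
  show ?thesis
  proof (rule that[of T])
    show "T \<subseteq> V" by (auto simp: T_def)
    show "N v \<inter> T \<noteq> {} \<and> \<not> N v \<subseteq> T" if "v \<in> V" for v
      using f that T_eq[OF that] by (auto simp: A_def all_def)
    show "card (N v \<inter> T) < m" if "v \<in> T" for v
      using f that T_eq[of v] by (auto simp: A_def many_def T_def not_le)
  qed
qed

section \<open>Choosing the density\<close>

text \<open>
  The second hypothesis says that the term at \<open>a + 1\<close> is at most the one at \<open>a\<close>; the ratios of
  consecutive terms decrease.
\<close>
lemma square_power_antimono:
  fixes q :: real and a k :: nat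
  assumes "0 \<le> q" and "(real a + 1)\<^sup>2 * q \<le> (real a)\<^sup>2" and "1 \<le> a" and "a \<le> k"
  shows "(real k)\<^sup>2 * q ^ k \<le> (real a)\<^sup>2 * q ^ a"
  using \<open>a \<le> k\<close>
proof (induction k rule: dec_induct)
  case base
  show ?case by simp
next
  case (step n)
  have "(real (Suc n) / real n)\<^sup>2 * q \<le> ((real a + 1) / real a)\<^sup>2 * q"
    using step assms by (intro mult_right_mono power_mono) (auto simp: field_simps)
  also have "\<dots> = (real a + 1)\<^sup>2 * q / (real a)\<^sup>2" by (simp add: power_divide)
  also have "\<dots> \<le> 1" using assms by (auto simp: divide_le_eq)
  finally have "(real (Suc n))\<^sup>2 * q \<le> (real n)\<^sup>2"
    using step assms by (simp add: power_divide field_simps)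
  then have "(real (Suc n))\<^sup>2 * q * q ^ n \<le> (real n)\<^sup>2 * q ^ n"
    using assms by (intro mult_right_mono) auto
  with step.IH show ?case by (simp add: mult_ac)
qed

lemma exp_1_ge: "271828 / 100000 \<le> exp (1 :: real)"
  using abs_le_D2[OF e_approx_32] by simp

lemma ln_ge_if_power_ge:
  assumes "1 \<le> k" and "(272 / 100) ^ r \<le> real k ^ s"
  shows "real r \<le> real s * ln (real k)"
proof -
  have "exp (real r) = exp 1 ^ r" by (simp flip: exp_of_nat_mult)
  also have "\<dots> \<le> (272 / 100) ^ r" using e_less_272 by (intro power_mono) auto
  also have "\<dots> \<le> real k ^ s" by fact
  finally have "ln (exp (real r)) \<le> ln (real k ^ s)"
    using assms(1) by (subst ln_le_cancel_iff) auto
  then show ?thesis using assms(1) by (simp add: ln_realpow)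
qed

text \<open>
  The density \<open>p\<close> and the base \<open>l\<close> of the Chernoff bound are good enough for the local lemma to
  split all neighborhoods of a \<open>k\<close>-regular graph by a set inducing degrees below \<open>m\<close>. The
  probability \<open>p ^ k\<close> that a neighborhood is contained in the random set is left out: for
  \<open>p \<le> 2 / 5\<close> and \<open>k \<ge> 19\<close> it is negligible, and the bound \<open>999 / 1000\<close> in place of \<open>1\<close>
  leaves room for it.
\<close>
definition sparse_density :: "nat \<Rightarrow> nat \<Rightarrow> real \<Rightarrow> real \<Rightarrow> bool" where
  "sparse_density k m p l \<longleftrightarrow> 0 \<le> p \<and> p \<le> 2 / 5 \<and> l \<ge> 1 \<and>
     4 * (real k)\<^sup>2 * ((1 - p) ^ k + p * ((1 + (l - 1) * p) ^ k / l ^ m)) \<le> 999 / 1000"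

text \<open>
  For fixed \<open>p\<close> and \<open>l\<close>, the first part of the criterion decreases with \<open>k\<close> and the second,
  for fixed \<open>m\<close>, increases, so that on an interval of degrees it is enough to evaluate them at
  opposite ends. The hypothesis on \<open>n\<close> says \<open>n \<le> 6 ln a\<close>, with \<open>2.72\<close> in place of \<open>e\<close>.
\<close>
lemma sparse_density_window:
  fixes p l :: real and a b m k :: nat
  assumes "a \<le> k" "k \<le> b" "1 \<le> a" and p: "0 \<le> p" "p \<le> 2 / 5" and "l \<ge> 1"
    and "(real a + 1)\<^sup>2 * (1 - p) \<le> (real a)\<^sup>2"
    and check: "4 * (real a)\<^sup>2 * (1 - p) ^ a
      + 4 * (real b)\<^sup>2 * p * ((1 + (l - 1) * p) ^ b / l ^ m) \<le> 999 / 1000"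
    and "(272 / 100) ^ n \<le> real a ^ 6" and "m = n + 2"
  shows "sparse_density k (nat \<lfloor>6 * ln (real k) + 2\<rfloor>) p l"
proof -
  have "ln (real a) \<le> ln (real k)" using assms by (subst ln_le_cancel_iff) auto
  moreover have "real n \<le> real 6 * ln (real a)" using assms by (intro ln_ge_if_power_ge) auto
  ultimately have m: "m \<le> nat \<lfloor>6 * ln (real k) + 2\<rfloor>"
    using \<open>m = n + 2\<close> by (simp add: le_nat_iff le_floor_iff)
  have "4 * (real k)\<^sup>2 * (1 - p) ^ k \<le> 4 * (real a)\<^sup>2 * (1 - p) ^ a"
    using square_power_antimono[of "1 - p" a k] assms by simp
  moreover have "4 * (real k)\<^sup>2 * (p * ((1 + (l - 1) * p) ^ k / l ^ nat \<lfloor>6 * ln (real k) + 2\<rfloor>))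
      \<le> 4 * (real b)\<^sup>2 * (p * ((1 + (l - 1) * p) ^ b / l ^ m))"
    using assms m by (intro mult_mono frac_le power_mono power_increasing order_refl) auto
  ultimately show ?thesis
    using check p \<open>l \<ge> 1\<close> unfolding sparse_density_def by (simp add: distrib_left mult.assoc)
qed

text \<open>
  With \<open>L = ln k\<close> and expected degree \<open>12/5 L\<close>, the two parts of the criterion are at most
  \<open>4 exp (-2/5 L)\<close> and \<open>4 * 24/25 L exp (-89/100 L)\<close>. Both decrease for \<open>L \<ge> 9/2\<close>, and their sum
  is below \<open>0.98\<close> there. The base \<open>5/2\<close> is the optimal one, namely the ratio of \<open>6 L\<close> to
  the expected degree.
\<close>
lemma sparse_density_large:
  assumes "94 \<le> k"
  shows "sparse_density k (nat \<lfloor>6 * ln (real k) + 2\<rfloor>) (12 / 5 * ln (real k) / real k) (5 / 2)"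
proof -
  define L where "L = ln (real k)"
  define p where "p = 12 / 5 * L / real k"
  define m where "m = nat \<lfloor>6 * L + 2\<rfloor>"
  have k: "real k > 0" using assms by simp
  have kL: "real k = exp L" using k by (simp add: L_def)
  have L: "9 / 2 \<le> L"
  proof -
    have "ln (94::real) \<le> L" using assms unfolding L_def by (subst ln_le_cancel_iff) auto
    moreover have "real 9 \<le> real 2 * ln (real 94)" by (rule ln_ge_if_power_ge) (auto simp: power_divide)
    ultimately show ?thesis by simp
  qed
  \<comment> \<open>The tangent of \<open>ln\<close> at \<open>94\<close> bounds \<open>L / k\<close>, and thus \<open>p\<close>.\<close>
  have "L \<le> 4 + real k / 94"
  proof -
    have "L = ln 94 + ln (real k / 94)" using k by (simp add: L_def ln_div)
    also have "ln (real k / 94) \<le> real k / 94 - 1" using k by (intro ln_le_minus_one) auto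
    also have "ln (94::real) \<le> 5"
    proof -
      have "(94::real) \<le> (5 / 2) ^ 5" by (simp add: power_divide)
      also have "\<dots> \<le> exp 1 ^ 5" using exp_1_ge by (intro power_mono) auto
      also have "\<dots> = exp 5" by (simp flip: exp_of_nat_mult)
      finally have "ln 94 \<le> ln (exp (5::real))" by (subst ln_le_cancel_iff) auto
      then show ?thesis by simp
    qed
    finally show ?thesis by simp
  qed
  then have p: "0 \<le> p" "p \<le> 2 / 5"
    using L k assms by (auto simp: p_def divide_le_eq)
  have ln52: "183 / 200 \<le> ln (5 / 2 :: real)"
  proof -
    \<comment> \<open>The claim is \<open>exp (183 / 200) \<le> 5 / 2\<close>, where \<open>183 / 200 = 1 - 17 / 200\<close>.\<close>
    have "1 + 17 / 200 + (17 / 200)\<^sup>2 / 2 \<le> exp (17 / 200 :: real)"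
      by (rule exp_lower_Taylor_quadratic) simp
    then have "exp (183 / 200) * (1 + 17 / 200 + (17 / 200)\<^sup>2 / 2) \<le> exp (183 / 200) * exp (17 / 200 :: real)"
      by (intro mult_left_mono) auto
    also have "\<dots> = exp 1" by (simp flip: exp_add)
    also have "\<dots> < 272 / 100" by (rule e_less_272)
    finally have "exp (183 / 200) \<le> (5 / 2 :: real)" by (simp add: power2_eq_square)
    then show ?thesis by (subst ln_ge_iff) auto
  qed
  have miss: "(real k)\<^sup>2 * (1 - p) ^ k \<le> exp (- (2 / 5) * L)"
  proof -
    have "(1 - p) ^ k \<le> exp (- p) ^ k" using p by (intro power_mono) (use exp_ge_add_one_self[of "- p"] in auto)
    also have "\<dots> = exp (- (12 / 5) * L)" using k by (simp add: p_def flip: exp_of_nat_mult)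
    finally have "(real k)\<^sup>2 * (1 - p) ^ k \<le> (real k)\<^sup>2 * exp (- (12 / 5) * L)"
      by (intro mult_left_mono) auto
    also have "\<dots> = exp (L + L + - (12 / 5) * L)" by (simp only: kL power2_eq_square exp_add)
    also have "L + L + - (12 / 5) * L = - (2 / 5) * L" by simp
    finally show ?thesis .
  qed
  have crowd: "(real k)\<^sup>2 * (p * ((1 + (5 / 2 - 1) * p) ^ k / (5 / 2) ^ m)) \<le> 24 / 25 * L * exp (- (89 / 100) * L)"
  proof -
    have "(1 + (5 / 2 - 1) * p) ^ k \<le> exp (3 / 2 * p) ^ k"
      using p exp_ge_add_one_self[of "3 / 2 * p"] by (intro power_mono) auto
    also have "\<dots> = exp (18 / 5 * L)" using k by (simp add: p_def flip: exp_of_nat_mult)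
    finally have num: "(1 + (5 / 2 - 1) * p) ^ k \<le> exp (18 / 5 * L)" .
    have "5 / 2 * exp (549 / 100 * L) \<le> 5 / 2 * exp (6 * L * ln (5 / 2))"
      using ln52 L mult_left_mono[OF ln52, of "6 * L"] by (simp add: algebra_simps)
    also have "\<dots> = (5 / 2) powr (6 * L + 1)" 
      by (simp only: powr_def distrib_right exp_add) simp
    also have "\<dots> \<le> (5 / 2) powr real m"
    proof -
      \<comment> \<open>This loses nothing but the rounding; the summand \<open>1\<close> yields the factor \<open>5 / 2\<close>.\<close>
      have "6 * L + 1 \<le> real m" using L unfolding m_def by linarith
      then show ?thesis by (intro powr_mono) auto
    qed
    also have "\<dots> = (5 / 2) ^ m" by (simp add: powr_realpow)
    finally have den: "5 / 2 * exp (549 / 100 * L) \<le> (5 / 2) ^ m" .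
    have "(real k)\<^sup>2 * (p * ((1 + (5 / 2 - 1) * p) ^ k / (5 / 2) ^ m))
        \<le> (real k)\<^sup>2 * (p * (exp (18 / 5 * L) / (5 / 2 * exp (549 / 100 * L))))"
      using p num den by (intro mult_left_mono frac_le) auto
    also have "\<dots> = 24 / 25 * L * (exp L * exp (18 / 5 * L) * exp (- (549 / 100 * L)))"
      by (simp add: p_def kL power2_eq_square exp_minus field_simps)
    also have "exp L * exp (18 / 5 * L) * exp (- (549 / 100 * L)) = exp (- (89 / 100) * L)"
      by (simp flip: exp_add)
    finally show ?thesis .
  qed
  have "exp (- (2 / 5) * L) \<le> 100 / 604"
  proof -
    have "exp (- (2 / 5) * L) \<le> exp (- (9 / 5))" using L by simp
    also have "\<dots> = inverse (exp (9 / 5))" by (rule exp_minus)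
    also have "\<dots> \<le> inverse (604 / 100)"
    proof (rule le_imp_inverse_le)
      have "(604 / 100) ^ 5 \<le> (271828 / 100000 :: real) ^ 9" by (simp add: power_divide)
      also have "\<dots> \<le> exp 1 ^ 9" using exp_1_ge by (intro power_mono) auto
      also have "\<dots> = exp (9 / 5) ^ 5" by (simp flip: exp_of_nat_mult)
      finally show "604 / 100 \<le> exp (9 / 5 :: real)" by (rule power_le_imp_le_base[of _ 4, simplified]) auto
    qed simp
    finally show ?thesis by simp
  qed
  moreover have "L * exp (- (89 / 100) * L) \<le> 9 / 2 * (10 / 545)"
  proof -
    define s where "s = L - 9 / 2"
    have s: "s \<ge> 0" "L = 9 / 2 + s" using L by (auto simp: s_def)
    have "L = 9 / 2 * (1 + 2 / 9 * s)" by (simp add: s)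
    also have "\<dots> \<le> 9 / 2 * exp (2 / 9 * s)" by (intro mult_left_mono exp_ge_add_one_self) auto
    also have "\<dots> \<le> 9 / 2 * exp (89 / 100 * s)" using s by simp
    finally have "L * exp (- (89 / 100) * L) \<le> 9 / 2 * exp (89 / 100 * s) * exp (- (89 / 100) * L)"
      by (intro mult_right_mono) auto
    also have "\<dots> = 9 / 2 * exp (- (801 / 200))"
      by (simp add: s algebra_simps flip: exp_add)
    also have "exp (- (801 / 200)) \<le> inverse (545 / 10 :: real)"
    proof -
      have "(545 / 10 :: real) \<le> (271828 / 100000) ^ 4" by (simp add: power_divide)
      also have "\<dots> \<le> exp 1 ^ 4" using exp_1_ge by (intro power_mono) auto
      also have "\<dots> = exp 4" by (simp flip: exp_of_nat_mult)
      also have "\<dots> \<le> exp (801 / 200)" by simp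
      finally show ?thesis unfolding exp_minus by (intro le_imp_inverse_le) auto
    qed
    finally show ?thesis by simp
  qed
  ultimately have "4 * (real k)\<^sup>2 * ((1 - p) ^ k + p * ((1 + (5 / 2 - 1) * p) ^ k / (5 / 2) ^ m)) \<le> 999 / 1000"
    using miss crowd by (simp only: distrib_left mult.assoc)
  with p show ?thesis unfolding sparse_density_def p_def m_def L_def by simp
qed

text \<open>
  For the degrees below \<open>94\<close>, where the asymptotic choice is too wasteful, the values of \<open>p\<close> and \<open>l\<close>
  were found by a numerical search; the intervals are about as long as the search permits.
\<close>
lemma sparse_density_exists:
  assumes "19 \<le> k"
  shows "\<exists>p l. sparse_density k (nat \<lfloor>6 * ln (real k) + 2\<rfloor>) p l"
proof -
  consider "k \<in> {19..26}" | "k \<in> {27..35}" | "k \<in> {36..45}" | "k \<in> {46..55}" | "k \<in> {56..68}"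
    | "k \<in> {69..80}" | "k \<in> {81..93}" | "94 \<le> k"
    using assms by force
  then show ?thesis
  proof cases
    case 1
    then have "sparse_density k (nat \<lfloor>6 * ln (real k) + 2\<rfloor>) (7 / 20) 5"
      by (intro sparse_density_window[of 19 _ 26 _ _ 19 17]) (auto simp: power_divide)
    then show ?thesis by blast
  next
    case 2
    then have "sparse_density k (nat \<lfloor>6 * ln (real k) + 2\<rfloor>) (4 / 15) (17 / 4)"
      by (intro sparse_density_window[of 27 _ 35 _ _ 21 19]) (auto simp: power_divide)
    then show ?thesis by blast
  next
    case 3
    then have "sparse_density k (nat \<lfloor>6 * ln (real k) + 2\<rfloor>) (7 / 30) (7 / 2)"
      by (intro sparse_density_window[of 36 _ 45 _ _ 23 21]) (auto simp: power_divide)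
    then show ?thesis by blast
  next
    case 4
    then have "sparse_density k (nat \<lfloor>6 * ln (real k) + 2\<rfloor>) (11 / 60) (7 / 2)"
      by (intro sparse_density_window[of 46 _ 55 _ _ 24 22]) (auto simp: power_divide)
    then show ?thesis by blast
  next
    case 5
    then have "sparse_density k (nat \<lfloor>6 * ln (real k) + 2\<rfloor>) (1 / 6) 3"
      by (intro sparse_density_window[of 56 _ 68 _ _ 26 24]) (auto simp: power_divide)
    then show ?thesis by blast
  next
    case 6
    then have "sparse_density k (nat \<lfloor>6 * ln (real k) + 2\<rfloor>) (3 / 20) 3"
      by (intro sparse_density_window[of 69 _ 80 _ _ 27 25]) (auto simp: power_divide)
    then show ?thesis by blast
  next
    case 7
    then have "sparse_density k (nat \<lfloor>6 * ln (real k) + 2\<rfloor>) (2 / 15) (11 / 4)"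
      by (intro sparse_density_window[of 81 _ 93 _ _ 28 26]) (auto simp: power_divide)
    then show ?thesis by blast
  next
    case 8
    then show ?thesis using sparse_density_large by blast
  qed
qed

lemma minus_one_le_6_ln:
  assumes "2 \<le> k" "k \<le> 18"
  shows "real k - 1 \<le> 6 * ln (real k)"
proof -
  have "k \<in> {2, 3, 4, 5, 6, 7, 8, 9, 10, 11, 12, 13, 14, 15, 16, 17, 18}"
    using assms by simp presburger
  then have "(272 / 100) ^ (k - 1) \<le> real k ^ 6"
    by (elim insertE) (simp_all add: power_divide)
  from ln_ge_if_power_ge[OF _ this] assms show ?thesis by simp
qed

section \<open>Dynamic colorings of regular graphs\<close>

lemma dynamic_chromatic_number_le:
  "dynamic_coloring G l c \<Longrightarrow> dynamic_chromatic_number G \<le> l"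
  unfolding dynamic_chromatic_number_def by (rule Least_le) blast

lemma card_image_ge_2:
  assumes "finite A" and "x \<in> A" and "y \<in> A" and "c x \<noteq> c y"
  shows "2 \<le> card (c ` A)"
proof -
  have "card {c x, c y} \<le> card (c ` A)" using assms by (intro card_mono) auto
  then show ?thesis using assms by simp
qed

lemma card_neighbors_regular:
  "regular_graph k G \<Longrightarrow> v \<in> pverts G \<Longrightarrow> card (neighbors G v) = k"
  by (simp add: regular_graph_def flip: out_degree_eq_card_neighbors)

context pair_graph
begin

lemma neighbors_subset: "neighbors G v \<subseteq> pverts G"
  by (auto simp: neighbors_def dest: arc_snd_in_verts)

lemma finite_neighbors: "finite (neighbors G v)"
  using neighbors_subset pair_finite_verts by (rule finite_subset)

lemma neighbors_sym: "u \<in> neighbors G v \<Longrightarrow> v \<in> neighbors G u"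
  using pair_sym_arcs by (auto simp: neighbors_def symmetric_conv)

lemma not_in_neighbors: "v \<notin> neighbors G v"
  using pair_no_loops[of "(v, v)"] by (auto simp: neighbors_def)

lemma neighbors_outside: "v \<notin> pverts G \<Longrightarrow> neighbors G v = {}"
  by (auto simp: neighbors_def dest: arc_fst_in_verts)

text \<open>
  Two systems of distinct representatives \<open>f\<close> and \<open>g\<close> of the neighborhoods, with
  \<open>f v \<noteq> g v\<close> for every \<open>v\<close>, single out two neighbors of each vertex. A proper coloring
  of the graph obtained by joining \<open>f v\<close> to \<open>g v\<close> for all \<open>v\<close> is dynamic. As \<open>f\<close> and
  \<open>g\<close> are injective, each vertex is an end of at most two of the new edges, so that the degrees
  are at most \<open>k + 2\<close>.
\<close>
lemma dynamic_chromatic_number_le_degree_plus_3: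
  assumes reg: "regular_graph k G" and "2 \<le> k"
  shows "dynamic_chromatic_number G \<le> k + 3"
proof -
  define V where "V = pverts G"
  define N where "N = neighbors G"
  have finV: "finite V" using pair_finite_verts by (simp add: V_def)
  have N: "N v \<subseteq> V" "finite (N v)" for v
    using neighbors_subset finite_neighbors by (auto simp: V_def N_def)
  have cardN: "card (N v) = k" if "v \<in> V" for v
    using card_neighbors_regular[OF reg] that by (simp add: V_def N_def)
  have sym: "u \<in> N v \<longleftrightarrow> v \<in> N u" for u v using neighbors_sym by (auto simp: N_def)
  have N_out: "N v = {}" if "v \<notin> V" for v using neighbors_outside that by (simp add: V_def N_def)
  have "card {v \<in> V. x \<in> N v} \<le> k" for x
  proof -
    have "{v \<in> V. x \<in> N v} = N x" using sym[of x] N by auto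
    then have "card {v \<in> V. x \<in> N v} = card (N x)" by (rule arg_cong)
    also have "\<dots> \<le> k" using cardN[of x] N_out[of x] by (cases "x \<in> V") auto
    finally show ?thesis .
  qed
  then obtain f where f: "inj_on f V" "\<And>v. v \<in> V \<Longrightarrow> f v \<in> N v"
    using regular_family_representatives[of V k N] finV N cardN \<open>2 \<le> k\<close> by auto
  have f_onto: "f ` V = V"
    using f N finV by (intro endo_inj_surj) auto
  \<comment> \<open>Since \<open>f\<close> is onto, deleting \<open>f v\<close> from each \<open>N v\<close> removes every point \<open>x\<close> from one
    of the sets, so the smaller sets form a \<open>(k - 1)\<close>-regular family.\<close>
  have "card {v \<in> V. x \<in> N v - {f v}} \<le> k - 1" for x
  proof (cases "x \<in> V")
    case True
    then obtain w where w: "w \<in> V" "x = f w" using f_onto by blast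
    then have "w \<in> N x" using f sym by blast
    have "{v \<in> V. x \<in> N v - {f v}} \<subseteq> N x - {w}" using sym[of x] w by auto
    then have "card {v \<in> V. x \<in> N v - {f v}} \<le> card (N x - {w})" using N by (intro card_mono) auto
    then show ?thesis using \<open>w \<in> N x\<close> cardN[OF True] N by simp
  next
    case False
    then have "{v \<in> V. x \<in> N v - {f v}} = {}" using N by auto
    then show ?thesis by (simp only: card.empty)
  qed
  moreover have "finite (N v - {f v}) \<and> card (N v - {f v}) = k - 1" if "v \<in> V" for v
    using N cardN[OF that] f(2)[OF that] by simp
  ultimately obtain g where g: "inj_on g V" "\<And>v. v \<in> V \<Longrightarrow> g v \<in> N v - {f v}"
    using regular_family_representatives[of V "k - 1" "\<lambda>v. N v - {f v}"] finV \<open>2 \<le> k\<close> by auto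
  define E where "E u v \<longleftrightarrow> u \<in> N v \<or> (\<exists>w\<in>V. {u, v} = {f w, g w})" for u v
  obtain c where c: "c ` V \<subseteq> {1..k + 3}" "\<And>u v. u \<in> V \<Longrightarrow> v \<in> V \<Longrightarrow> E u v \<Longrightarrow> c u \<noteq> c v"
  proof (rule greedy_coloring[of V "{1..k + 3}" E])
    show "E v u" if "E u v" for u v using that sym[of u v] by (auto simp: E_def insert_commute)
    show "\<not> E v v" for v
    proof -
      have "f w \<noteq> g w \<and> g w \<noteq> f w" if "w \<in> V" for w using g(2)[OF that] by auto
      then show ?thesis using not_in_neighbors[of v] by (auto simp: E_def N_def doubleton_eq_iff)
    qed
    fix v assume v: "v \<in> V"
    let ?a = "g (inv_into V f v)" and ?b = "f (inv_into V g v)"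
    have "{u \<in> V. E v u} \<subseteq> N v \<union> {?a, ?b}"
    proof
      fix u assume "u \<in> {u \<in> V. E v u}"
      then consider "v \<in> N u" | w where "w \<in> V" "{v, u} = {f w, g w}" by (auto simp: E_def)
      then show "u \<in> N v \<union> {?a, ?b}"
      proof cases
        case 1
        then show ?thesis using sym by auto
      next
        case 2
        then show ?thesis
          using inv_into_f_f[OF f(1), of w] inv_into_f_f[OF g(1), of w] by (auto simp: doubleton_eq_iff)
      qed
    qed
    then have "card {u \<in> V. E v u} \<le> card (N v \<union> {?a, ?b})" using N by (intro card_mono) auto
    also have "\<dots> \<le> card (N v) + card {?a, ?b}" by (rule card_Un_le)
    also have "\<dots> \<le> k + 2" using cardN[OF v] by (intro add_mono) (auto simp: card_insert_if)
    finally show "card {u \<in> V. E v u} < card {1..k + 3}" by simp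
  qed (use finV in auto)
  have "dynamic_coloring G (k + 3) c"
    unfolding dynamic_coloring_def proper_coloring_def
  proof (intro conjI ballI impI)
    show "c ` pverts G \<subseteq> {1..k + 3}" using c(1) by (simp add: V_def)
    show "case e of (u, v) \<Rightarrow> c u \<noteq> c v" if "e \<in> parcs G" for e
    proof (cases e)
      case (Pair u v)
      then have "v \<in> N u" using that by (simp add: N_def neighbors_def)
      then have "u \<in> V" "v \<in> V" "E u v" using N[of u] N_out[of u] sym by (auto simp: E_def)
      then show ?thesis using c(2) Pair by simp
    qed
    fix v assume "v \<in> pverts G"
    then have v: "v \<in> V" by (simp add: V_def)
    have "f v \<in> N v" "g v \<in> N v" using f g v by auto
    moreover from this have "c (f v) \<noteq> c (g v)" using N v by (intro c(2)) (auto simp: E_def)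
    ultimately have "2 \<le> card (c ` N v)" by (rule card_image_ge_2[OF N(2)])
    then show "card (c ` neighbors G v) \<ge> 2" by (simp add: N_def)
  qed
  then show ?thesis by (rule dynamic_chromatic_number_le)
qed

text \<open>
  An optimal proper coloring is kept outside the set \<open>T\<close> given by the local lemma, and \<open>T\<close>
  itself is recolored greedily with \<open>m\<close> new colors. Each neighborhood meets both \<open>T\<close> and its
  complement, hence contains both a new and an old color.
\<close>
lemma dynamic_chromatic_number_le_of_sparse_density:
  assumes reg: "regular_graph k G" and "19 \<le> k" and dens: "sparse_density k m p l"
  shows "dynamic_chromatic_number G \<le> chromatic_number G + m"
proof -
  define V where "V = pverts G"
  define N where "N = neighbors G"
  define x where "x = chromatic_number G"
  have finV: "finite V" using pair_finite_verts by (simp add: V_def)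
  have N: "N v \<subseteq> V" "finite (N v)" for v
    using neighbors_subset finite_neighbors by (auto simp: V_def N_def)
  have p: "0 \<le> p" "p \<le> 2 / 5" "l \<ge> 1"
    and main: "4 * (real k)\<^sup>2 * ((1 - p) ^ k + p * ((1 + (l - 1) * p) ^ k / l ^ m)) \<le> 999 / 1000"
    using dens by (simp_all add: sparse_density_def)
  \<comment> \<open>The term \<open>p ^ k\<close>, absent from \<open>sparse_density\<close>, fits into the remaining \<open>1 / 1000\<close>.\<close>
  have "(real k)\<^sup>2 * p ^ k \<le> (real k)\<^sup>2 * (2 / 5) ^ k"
    using p by (intro mult_left_mono power_mono) auto
  also have "\<dots> \<le> (real 19)\<^sup>2 * (2 / 5) ^ 19"
    using \<open>19 \<le> k\<close> by (intro square_power_antimono) auto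
  also have "\<dots> \<le> 1 / 4000" by (simp add: power_divide)
  finally have "4 * (real k)\<^sup>2 * ((1 - p) ^ k + p ^ k + p * ((1 + (l - 1) * p) ^ k / l ^ m)) \<le> 1"
    using main by (simp add: distrib_left)
  note small = this
  obtain T where T: "T \<subseteq> V" "\<And>v. v \<in> V \<Longrightarrow> N v \<inter> T \<noteq> {} \<and> \<not> N v \<subseteq> T"
    "\<And>v. v \<in> T \<Longrightarrow> card (N v \<inter> T) < m"
  proof (rule sparse_splitting_set[OF finV, of k N p l m])
    show "N v \<subseteq> V \<and> card (N v) = k" if "v \<in> V" for v
      using N card_neighbors_regular[OF reg] that by (simp add: N_def V_def)
    show "v \<in> N u" if "u \<in> N v" for u v using neighbors_sym that by (simp add: N_def)
    show "v \<notin> N v" for v using not_in_neighbors by (simp add: N_def)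
  qed (use \<open>19 \<le> k\<close> p small in auto)
  obtain c1 where c1: "c1 ` T \<subseteq> {x + 1..x + m}" "\<And>u v. u \<in> T \<Longrightarrow> v \<in> T \<Longrightarrow> u \<in> N v \<Longrightarrow> c1 u \<noteq> c1 v"
  proof (rule greedy_coloring[of T "{x + 1..x + m}" "\<lambda>u v. u \<in> N v"])
    show "finite T" using T finV finite_subset by blast
    fix v assume "v \<in> T"
    moreover have "{u \<in> T. v \<in> N u} = N v \<inter> T" using neighbors_sym by (auto simp: N_def)
    ultimately show "card {u \<in> T. v \<in> N u} < card {x + 1..x + m}" using T(3) by simp
  qed (use neighbors_sym not_in_neighbors in \<open>auto simp: N_def\<close>)
  obtain c0 where "proper_coloring G x c0"
    using proper_coloring_chromatic_number by (auto simp: x_def)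
  then have c0: "c0 ` V \<subseteq> {1..x}" "\<And>u v. (u, v) \<in> parcs G \<Longrightarrow> c0 u \<noteq> c0 v"
    by (auto simp: proper_coloring_def V_def)
  define c where "c v = (if v \<in> T then c1 v else c0 v)" for v
  have range: "x < c v \<and> c v \<le> x + m" if "v \<in> T" for v
    using c1(1) that by (force simp: c_def)
  have range0: "1 \<le> c v \<and> c v \<le> x" if "v \<in> V" "v \<notin> T" for v
    using c0(1) that by (force simp: c_def)
  have "dynamic_coloring G (x + m) c"
    unfolding dynamic_coloring_def proper_coloring_def
  proof (intro conjI ballI impI)
    show "c ` pverts G \<subseteq> {1..x + m}"
    proof
      fix y assume "y \<in> c ` pverts G"
      then obtain v where "y = c v" "v \<in> V" by (auto simp: V_def)
      then show "y \<in> {1..x + m}" using range[of v] range0[of v] by (cases "v \<in> T") auto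
    qed
    show "case e of (u, v) \<Rightarrow> c u \<noteq> c v" if "e \<in> parcs G" for e
    proof (cases e)
      case (Pair u v)
      then have uv: "u \<in> N v" "u \<in> V" "v \<in> V" "c0 u \<noteq> c0 v"
        using that neighbors_sym[of v u] c0(2) N(1)[of u] N(1)[of v] by (auto simp: N_def neighbors_def)
      have "c u \<noteq> c v"
      proof (cases "u \<in> T \<longleftrightarrow> v \<in> T")
        case True
        then show ?thesis using c1(2)[of u v] uv by (auto simp: c_def)
      next
        case False
        then show ?thesis using range[of u] range0[of u] range[of v] range0[of v] uv by fastforce
      qed
      then show ?thesis using Pair by simp
    qed
    fix v assume "v \<in> pverts G"
    then obtain y z where yz: "y \<in> N v" "y \<in> T" "z \<in> N v" "z \<notin> T"
      using T(2)[of v] by (auto simp: V_def)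
    then have "c y \<noteq> c z" using range[of y] range0[of z] N by fastforce
    with yz have "2 \<le> card (c ` N v)" by (intro card_image_ge_2[OF N(2)])
    then show "card (c ` neighbors G v) \<ge> 2" by (simp add: N_def)
  qed
  then show ?thesis unfolding x_def by (rule dynamic_chromatic_number_le)
qed

lemma chromatic_number_ge_2:
  assumes "parcs G \<noteq> {}"
  shows "2 \<le> chromatic_number G"
proof -
  obtain c where c: "c ` pverts G \<subseteq> {1..chromatic_number G}" "\<forall>(u, v)\<in>parcs G. c u \<noteq> c v"
    using proper_coloring_chromatic_number by (auto simp: proper_coloring_def)
  obtain u v where uv: "(u, v) \<in> parcs G" using assms by auto
  then have "u \<in> pverts G" "v \<in> pverts G" by (auto dest: arc_fst_in_verts arc_snd_in_verts)
  with c uv have "c u \<in> {1..chromatic_number G}" "c v \<in> {1..chromatic_number G}" "c u \<noteq> c v" by auto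
  then show ?thesis by auto
qed

end

theorem theorem3:
  fixes k :: nat and G :: "'a pair_pre_digraph"
  assumes "k \<ge> 1" and "pair_graph G" and "regular_graph k G"
  shows "real (dynamic_chromatic_number G) - real (chromatic_number G) \<le> 6 * ln (real k) + 2"
proof -
  interpret pair_graph G by fact
  have ln_k: "ln (real k) \<ge> 0" using \<open>k \<ge> 1\<close> by simp
  consider "pverts G = {}" | "k = 1" | "pverts G \<noteq> {}" "2 \<le> k" "k \<le> 18" | "19 \<le> k"
    using \<open>k \<ge> 1\<close> by linarith
  then show ?thesis
  proof cases
    case 1
    then have "parcs G = {}" by (auto dest: arc_fst_in_verts)
    with 1 have "dynamic_coloring G 0 (\<lambda>_. 0)"
      by (simp add: dynamic_coloring_def proper_coloring_def)
    from dynamic_chromatic_number_le[OF this] ln_k show ?thesis by simp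
  next
    case 2
    obtain c where "proper_coloring G (chromatic_number G) c"
      using proper_coloring_chromatic_number by blast
    then have "dynamic_coloring G (chromatic_number G) c"
      using \<open>regular_graph k G\<close> 2 by (simp add: dynamic_coloring_def regular_graph_def)
    from dynamic_chromatic_number_le[OF this] ln_k show ?thesis by simp
  next
    case 3
    from 3 obtain v where "v \<in> pverts G" by blast
    then have "neighbors G v \<noteq> {}"
      using card_neighbors_regular[OF \<open>regular_graph k G\<close>] 3 by fastforce
    then have "2 \<le> chromatic_number G"
      by (intro chromatic_number_ge_2) (auto simp: neighbors_def)
    moreover have "dynamic_chromatic_number G \<le> k + 3"
      using \<open>regular_graph k G\<close> 3 by (intro dynamic_chromatic_number_le_degree_plus_3)
    ultimately show ?thesis using minus_one_le_6_ln 3 by fastforce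
  next
    case 4
    from sparse_density_exists[OF 4] obtain p l
      where "sparse_density k (nat \<lfloor>6 * ln (real k) + 2\<rfloor>) p l" by blast
    with \<open>regular_graph k G\<close> 4
    have "dynamic_chromatic_number G \<le> chromatic_number G + nat \<lfloor>6 * ln (real k) + 2\<rfloor>"
      by (intro dynamic_chromatic_number_le_of_sparse_density)
    moreover have "real (nat \<lfloor>6 * ln (real k) + 2\<rfloor>) \<le> 6 * ln (real k) + 2"
      using ln_k by simp
    ultimately show ?thesis by linarith
  qed
qed

end
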